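(* Let $N>1$ be an integer, let $n\ge 1$ be an integer, and let $\alpha_n(N)$ be the largest root of the quadratic $x^{2}-2NF_{n}x-F_{n}\tilde F_{n}(2N)$, that is, $$\alpha_n(N)=NF_n+\sqrt{N^2F_n^2+F_n\tilde F_n(2N)}.$$ If $n$ is odd, then the continued fraction of $\alpha_n(N)$ is $$\alpha_n(N)=[\tilde F_{n+1}(2N),\overline{2\tilde F_{n+1}(N)}],$$ and if $n$ is even, then it is $$\alpha_n(N)=[\tilde F_{n+1}(2N)-1,\overline{1,\,2\tilde F_{n+1}(N)-2}].$$
   Context: $F_n$ denotes the Fibonacci numbers: $F_0=0$, $F_1=F_2=1$, $F_{n+1}=F_n+F_{n-1}$. For a positive integer $m$, the Fibonacci-like numbers $\tilde F_n(m)$ are defined by $\tilde F_0(m)=0$, $\tilde F_1(m)=1$, $\tilde F_2(m)=m$ and $\tilde F_n(m)=\tilde F_{n-1}(m)+\tilde F_{n-2}(m)$ for $n\ge 3$; equivalently $\tilde F_{n+1}(m)=mF_n+F_{n-1}$ for $n\ge1$. The notation $[a_0,a_1,a_2,\dots]$ denotes the continued fraction $a_0+\cfrac{1}{a_1+\cfrac{1}{a_2+\cdots}}$ (an infinite one is the limit of its convergents), and $[a_0,\dots,a_r,\overline{b_1,\dots,b_s}]$ denotes the periodic continued fraction in which the block $b_1,\dots,b_s$ is repeated indefinitely. *)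

theory Defs
  imports Complex_Main "HOL-Number_Theory.Fib"
begin

fun fib_like :: "int \<Rightarrow> nat \<Rightarrow> int" where
  "fib_like m 0 = 0"
| "fib_like m (Suc 0) = 1"
| "fib_like m (Suc (Suc 0)) = m"
| "fib_like m (Suc (Suc (Suc n))) = fib_like m (Suc (Suc n)) + fib_like m (Suc n)"

lemma fib_like_Suc_Suc: "fib_like m (Suc (Suc n)) = m * int (fib (Suc n)) + int (fib n)"
  by (induction n rule: fib.induct) (simp_all add: algebra_simps)

primrec cf_convergent :: "(nat \<Rightarrow> int) \<Rightarrow> nat \<Rightarrow> real" where
  "cf_convergent a 0 = of_int (a 0)"
| "cf_convergent a (Suc k) = of_int (a 0) + 1 / cf_convergent (\<lambda>i. a (Suc i)) k"

text \<open>
  Infinite regular continued fraction expansions. Positivity of the partial quotients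
  from index 1 on makes the sequence \<open>a\<close> uniquely determined by \<open>x\<close>,
  so one may speak of the continued fraction of \<open>x\<close>.
\<close>

definition has_cfrac :: "real \<Rightarrow> (nat \<Rightarrow> int) \<Rightarrow> bool" where
  "has_cfrac x a \<longleftrightarrow> (\<forall>i\<ge>1. a i > 0) \<and> cf_convergent a \<longlonglongrightarrow> x"

definition periodic :: "int list \<Rightarrow> int list \<Rightarrow> nat \<Rightarrow> int" where
  "periodic as bs i =
     (if i < length as then as ! i else bs ! ((i - length as) mod length bs))"

text \<open>The root set is finite and nonempty for \<open>N > 1\<close> and \<open>n \<ge> 1\<close>, so \<open>Max\<close> is meaningful there.\<close>

definition alpha :: "int \<Rightarrow> nat \<Rightarrow> real" where
  "alpha N n = Max {x :: real. x\<^sup>2 - 2 * of_int N * of_nat (fib n) * x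
                                - of_nat (fib n) * of_int (fib_like (2 * N) n) = 0}"

end

(*
  Write F = fib n and A = N * F + fib (n - 1), which is fib_like N (n + 1).  By Cassini's identity
  the radicand is A^2 + 1 for odd n and A^2 - 1 for even n, and fib_like (2 * N) (n + 1) = N * F + A.
  So alpha is a translate by N * F of sqrt (A^2 + 1) = [A, 2A, 2A, ...] or of
  sqrt (A^2 - 1) = [A - 1, 1, 2A - 2, 1, 2A - 2, ...].
*)
theory Submission
  imports Defs
begin

text \<open>Keeps the denominators of tail convergents away from 0. Positivity is required at index
  0 as well because the lemma is applied to shifted sequences, whose head is a later partial
  quotient.\<close>

lemma cf_convergent_ge_1:
  assumes "\<And>i. a i > 0"
  shows "cf_convergent a k \<ge> 1"
  using assms
proof (induction k arbitrary: a)
  case 0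
  from "0.prems"[of 0] show ?case by simp
next
  case (Suc k)
  have "cf_convergent (\<lambda>i. a (Suc i)) k \<ge> 1"
    by (intro Suc.IH Suc.prems)
  with Suc.prems[of 0] show ?case
    by (simp add: add_increasing2)
qed

text \<open>
  Consecutive complete quotients satisfy \<open>x 1 * x 2 = a 1 * x 2 + 1 \<ge> 2\<close>, so two steps at least
  halve the error.
\<close>

lemma cf_convergent_error:
  fixes x :: "nat \<Rightarrow> real"
  assumes "\<And>i. i \<ge> 1 \<Longrightarrow> a i > 0" and "\<And>i. i \<ge> 1 \<Longrightarrow> x i > 0"
    and "\<And>i. x i = of_int (a i) + 1 / x (Suc i)"
  shows "\<bar>cf_convergent a k - x 0\<bar> \<le> 2 * (1 / 2) ^ (k div 2)"
  using assms
\<comment> \<open>\<open>fib.induct\<close> serves as an induction in steps of two, matching the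
  exponent \<open>k div 2\<close>. The sequences vary because the hypothesis is used on their tails
  from index 2 on.\<close>
proof (induction k arbitrary: a x rule: fib.induct)
  case (1 a x)
  have "x 1 \<ge> 1"
    using "1.prems"(1)[of 1] "1.prems"(2)[of 2] "1.prems"(3)[of 1]
    by (simp add: numeral_2_eq_2 add_increasing2)
  then have "1 / x 1 \<le> 1" "1 / x 1 \<ge> 0" by auto
  with "1.prems"(3)[of 0] show ?case by simp
next
  case (2 a x)
  have "x 1 \<ge> 1"
    using "2.prems"(1)[of 1] "2.prems"(2)[of 2] "2.prems"(3)[of 1]
    by (simp add: numeral_2_eq_2 add_increasing2)
  then have "1 / x 1 \<le> 1" "1 / x 1 \<ge> 0" by auto
  moreover have "1 / real_of_int (a 1) \<le> 1" "1 / real_of_int (a 1) \<ge> 0"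
    using "2.prems"(1)[of 1] by auto
  ultimately have "\<bar>1 / real_of_int (a 1) - 1 / x 1\<bar> \<le> 2" by linarith
  with "2.prems"(3)[of 0] show ?case by simp
next
  case (3 k a x)
  define c where "c = cf_convergent (\<lambda>i. a (Suc i)) (Suc k)"
  define d where "d = cf_convergent (\<lambda>i. a (Suc (Suc i))) k"
  have IH: "\<bar>d - x 2\<bar> \<le> 2 * (1 / 2) ^ (k div 2)"
  proof -
    have "\<bar>d - x (Suc (Suc 0))\<bar> \<le> 2 * (1 / 2) ^ (k div 2)"
      unfolding d_def
      by (rule "3.IH"(2)[of "\<lambda>i. a (Suc (Suc i))" "\<lambda>i. x (Suc (Suc i))"])
        (intro "3.prems"; simp)+
    then show ?thesis by (simp add: numeral_2_eq_2)
  qed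
  have c: "c \<ge> 1" and d: "d \<ge> 1"
    unfolding c_def d_def by (intro cf_convergent_ge_1 "3.prems"(1); simp)+
  have c_eq: "c = of_int (a 1) + 1 / d" by (simp add: c_def d_def)
  have x1: "x 1 = of_int (a 1) + 1 / x 2"
    using "3.prems"(3)[of 1] by (simp add: numeral_2_eq_2)
  have pos: "x 1 > 0" "x 2 > 0" using "3.prems"(2) by auto
  have a1: "real_of_int (a 1) \<ge> 1" using "3.prems"(1)[of 1] by simp
  have x2: "x 2 \<ge> 1"
    using "3.prems"(1)[of 2] "3.prems"(2)[of 3] "3.prems"(3)[of 2]
    by (simp add: numeral_2_eq_2 numeral_3_eq_3 add_increasing2)
  have "x 1 * x 2 = of_int (a 1) * x 2 + 1" using x1 pos by (simp add: field_simps)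
  moreover have "of_int (a 1) * x 2 \<ge> 1 * 1" using a1 x2 by (intro mult_mono) auto
  moreover have "c * d = of_int (a 1) * d + 1" using c_eq d by (simp add: field_simps)
  moreover have "of_int (a 1) * d \<ge> 1 * 1" using a1 d by (intro mult_mono) auto
  ultimately have prods: "x 1 * x 2 \<ge> 2" "c * d \<ge> 2" by simp_all
  have "2 * 1 \<le> (x 1 * x 2) * (c * d)" using prods by (intro mult_mono) auto
  then have den: "(x 1 * x 2) * (c * d) \<ge> 2" by simp
  \<comment> \<open>Each of the two reciprocals flips the sign of the error and divides it by a
    product of two denominators, so the tail error \<open>d - x 2\<close> returns with its sign and
    the factor \<open>1 / ((x 1 * x 2) * (c * d))\<close>.\<close>
  have "cf_convergent a (Suc (Suc k)) - x 0 = 1 / c - 1 / x 1"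
    using "3.prems"(3)[of 0] by (simp add: c_def)
  also have "\<dots> = (x 1 - c) / (x 1 * c)" using c pos by (simp add: field_simps)
  also have "x 1 - c = (d - x 2) / (x 2 * d)"
    unfolding c_eq x1 using d pos by (simp add: field_simps)
  also have "\<dots> / (x 1 * c) = (d - x 2) / ((x 1 * x 2) * (c * d))" by (simp add: mult_ac)
  finally have "\<bar>cf_convergent a (Suc (Suc k)) - x 0\<bar>
      = \<bar>d - x 2\<bar> / ((x 1 * x 2) * (c * d))"
    using den by (simp add: abs_divide)
  also have "\<dots> \<le> \<bar>d - x 2\<bar> / 2"
    using den by (intro divide_left_mono) auto
  also have "\<dots> \<le> 2 * (1 / 2) ^ (Suc (Suc k) div 2)" using IH by simp
  finally show ?case .
qed

text \<open>Reduces an expansion to exhibiting its complete quotients \<open>x i\<close>: the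
  geometric error bound then forces the convergents to \<open>x 0\<close>.\<close>

lemma has_cfracI_complete_quotients:
  fixes x :: "nat \<Rightarrow> real"
  assumes "\<And>i. i \<ge> 1 \<Longrightarrow> a i > 0" and "\<And>i. i \<ge> 1 \<Longrightarrow> x i > 0"
    and "\<And>i. x i = of_int (a i) + 1 / x (Suc i)"
  shows "has_cfrac (x 0) a"
proof -
  have "filterlim (\<lambda>k::nat. k div 2) at_top sequentially"
    by (rule filterlim_at_top_div_const_nat) simp
  then have lim: "(\<lambda>k. (1 / 2 :: real) ^ (k div 2)) \<longlonglongrightarrow> 0"
    by (rule filterlim_compose[rotated]) (simp add: LIMSEQ_power_zero)
  have "(\<lambda>k. cf_convergent a k - x 0) \<longlonglongrightarrow> 0"
  proof (rule tendsto_0_le[OF lim always_eventually], rule allI)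
    show "norm (cf_convergent a k - x 0) \<le> norm ((1 / 2 :: real) ^ (k div 2)) * 2" for k
      using cf_convergent_error[of a x k, OF assms] by (simp add: mult.commute)
  qed
  then have "cf_convergent a \<longlonglongrightarrow> x 0" by (rule LIM_zero_cancel)
  with assms(1) show ?thesis by (simp add: has_cfrac_def)
qed

text \<open>With \<open>s\<close> the square root, \<open>(s - A) * (s + A) = 1\<close>, so every
  complete quotient from index 1 on is \<open>A + s\<close>. The shift \<open>b\<close> affects
  index 0 only.\<close>

lemma has_cfrac_sqrt_square_plus_1:
  fixes A b :: int
  assumes "A \<ge> 1"
  shows "has_cfrac (of_int b + sqrt ((of_int A)\<^sup>2 + 1)) (periodic [b + A] [2 * A])"
proof -
  define s where "s = sqrt ((real_of_int A)\<^sup>2 + 1)"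
  define x where "x i = (if i = 0 then of_int b + s else of_int A + s)" for i :: nat
  have s: "s * s = (of_int A)\<^sup>2 + 1" "s > 0"
    unfolding s_def by (auto simp: add_nonneg_pos)
  have pos: "of_int A + s > 0" using s assms by simp
  have eq: "s - of_int A = 1 / (of_int A + s)"
    using s pos by (simp add: field_simps power2_eq_square)
  have "has_cfrac (x 0) (periodic [b + A] [2 * A])"
  proof (rule has_cfracI_complete_quotients)
    show "x i = of_int (periodic [b + A] [2 * A] i) + 1 / x (Suc i)" for i
      using eq by (simp add: x_def periodic_def)
  qed (use assms pos in \<open>simp_all add: x_def periodic_def\<close>)
  then show ?thesis by (simp add: x_def s_def)
qed

text \<open>From index 1 on the complete quotients alternate between \<open>u / (2 * A - 2)\<close>
  and \<open>u\<close>, where \<open>u = A + s - 1\<close>. The bound on \<open>A\<close> makes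
  \<open>2 * A - 2\<close> positive.\<close>

lemma has_cfrac_sqrt_square_minus_1:
  fixes A b :: int
  assumes "A \<ge> 2"
  shows "has_cfrac (of_int b + sqrt ((of_int A)\<^sup>2 - 1)) (periodic [b + A - 1] [1, 2 * A - 2])"
proof -
  define s where "s = sqrt ((real_of_int A)\<^sup>2 - 1)"
  define u where "u = of_int A + s - 1"
  define x where "x i = (if i = 0 then of_int b + s else if odd i then u / (2 * of_int A - 2) else u)"
    for i :: nat
  have A: "real_of_int A \<ge> 2" using assms by simp
  then have "(real_of_int A)\<^sup>2 \<ge> 1" by simp
  then have s: "s * s = (of_int A)\<^sup>2 - 1" "s \<ge> 0"
    unfolding s_def by simp_all
  have pos: "u > 0" using s A by (simp add: u_def)
  \<comment> \<open>Difference of squares: \<open>s * s - (A - 1) * (A - 1)\<close> with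
    \<open>s * s = A * A - 1\<close>.\<close>
  have "(s - of_int A + 1) * u = 2 * of_int A - 2"
    using s by (simp add: u_def algebra_simps power2_eq_square)
  then have u: "(2 * of_int A - 2) / u = s - of_int A + 1"
    using pos by (simp add: field_simps)
  have eq0: "s - of_int A + 1 = 1 / (u / (2 * of_int A - 2))"
    using u by simp
  have eq1: "u / (2 * of_int A - 2) = 1 + 1 / u"
  proof -
    have "u * u = (2 * of_int A - 2) * (u + 1)"
      using s by (simp add: u_def algebra_simps power2_eq_square)
    then show ?thesis using pos A by (simp add: field_simps)
  qed
  have eq2: "u = 2 * of_int A - 2 + 1 / (u / (2 * of_int A - 2))"
    using eq0 by (simp add: u_def)
  \<comment> \<open>The block starts at index 1, so its first entry 1 falls on odd indices.\<close>
  have per: "periodic [b + A - 1] [1, 2 * A - 2] i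
      = (if i = 0 then b + A - 1 else if odd i then 1 else 2 * A - 2)" for i
    by (cases i) (simp_all add: periodic_def mod_2_eq_odd numeral_2_eq_2[symmetric])
  have "has_cfrac (x 0) (periodic [b + A - 1] [1, 2 * A - 2])"
  proof (rule has_cfracI_complete_quotients)
    show "x i = of_int (periodic [b + A - 1] [1, 2 * A - 2] i) + 1 / x (Suc i)" for i
      using eq0 eq1 eq2 by (simp add: x_def per)
  qed (use assms A pos in \<open>simp_all add: x_def per\<close>)
  then show ?thesis by (simp add: x_def s_def)
qed

text \<open>The polynomial factors with roots \<open>p + s\<close> and \<open>p - s\<close>, and
  \<open>s \<ge> 0\<close> decides which is larger.\<close>

lemma Max_roots_monic_quadratic:
  fixes p q :: real
  assumes "p\<^sup>2 + q \<ge> 0"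
  shows "Max {x. x\<^sup>2 - 2 * p * x - q = 0} = p + sqrt (p\<^sup>2 + q)"
proof -
  define s where "s = sqrt (p\<^sup>2 + q)"
  have s: "s * s = p\<^sup>2 + q" "s \<ge> 0" using assms by (simp_all add: s_def)
  have "x\<^sup>2 - 2 * p * x - q = (x - (p + s)) * (x - (p - s))" for x
    using s by (simp add: algebra_simps power2_eq_square)
  then have "{x. x\<^sup>2 - 2 * p * x - q = 0} = {p + s, p - s}" by auto
  then show ?thesis using s by (simp add: s_def[symmetric])
qed

text \<open>Completing the square in \<open>N * fib (Suc m)\<close> leaves
  \<open>fib (Suc m) * fib (m - 1) - (fib m)\<^sup>2\<close> for positive \<open>m\<close>, which is
  \<open>(- 1) ^ m\<close> by Cassini. The case \<open>m = 0\<close> is separate because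
  \<open>fib_like_Suc_Suc\<close> starts at index 2.\<close>

lemma radicand_eq:
  "N\<^sup>2 * (int (fib (Suc m)))\<^sup>2 + int (fib (Suc m)) * fib_like (2 * N) (Suc m)
    = (fib_like N (Suc (Suc m)))\<^sup>2 + (- 1) ^ m"
proof (cases m)
  case 0
  then show ?thesis by simp
next
  case (Suc j)
  have "int (fib (Suc (Suc j))) * int (fib j) = (int (fib (Suc j)))\<^sup>2 - (- 1) ^ j"
    using fib_Cassini_int[of j] by simp
  then show ?thesis
    unfolding Suc fib_like_Suc_Suc by (simp add: algebra_simps power2_eq_square del: fib.simps)
qed

theorem theorem1:
  fixes N :: int and n :: nat
  assumes "N > 1" and "n \<ge> 1"
  shows "alpha N n = of_int N * of_nat (fib n)
           + sqrt ((of_int N)\<^sup>2 * (of_nat (fib n))\<^sup>2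
                   + of_nat (fib n) * of_int (fib_like (2 * N) n))
       \<and> (odd n \<longrightarrow> has_cfrac (alpha N n)
              (periodic [fib_like (2 * N) (n + 1)] [2 * fib_like N (n + 1)]))
       \<and> (even n \<longrightarrow> has_cfrac (alpha N n)
              (periodic [fib_like (2 * N) (n + 1) - 1] [1, 2 * fib_like N (n + 1) - 2]))"
proof -
  obtain m where n: "n = Suc m" using assms(2) by (cases n) auto
  define A where "A = fib_like N (n + 1)"
  define b where "b = N * int (fib n)"
  define q where "q = int (fib n) * fib_like (2 * N) n"
  have "int (fib n) \<ge> 1" using fib_neq_0_nat[of n] n by simp
  then have "N * int (fib n) \<ge> 2 * 1" using assms(1) by (intro mult_mono) auto
  then have A: "A \<ge> 2" by (simp add: A_def n fib_like_Suc_Suc del: fib.simps)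
  \<comment> \<open>Doubling the parameter adds one more \<open>N * fib n\<close>, exactly the
    translation \<open>b\<close> in \<open>alpha\<close>.\<close>
  have bA: "fib_like (2 * N) (n + 1) = b + A"
    by (simp add: A_def b_def n fib_like_Suc_Suc del: fib.simps)
  have "b\<^sup>2 + q = A\<^sup>2 + (- 1) ^ m"
    using radicand_eq[of N m] by (simp add: A_def b_def q_def n power_mult_distrib)
  then have "real_of_int (b\<^sup>2 + q) = of_int (A\<^sup>2 + (- 1) ^ m)" by (rule arg_cong)
  then have rad: "(real_of_int b)\<^sup>2 + of_int q = (of_int A)\<^sup>2 + (- 1) ^ m" by simp
  \<comment> \<open>Since \<open>n = Suc m\<close>, the sign is negative for even \<open>n\<close>;
    there this bound keeps the radicand nonnegative.\<close>
  have "(real_of_int A)\<^sup>2 \<ge> 1" using A by simp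
  then have nonneg: "(real_of_int b)\<^sup>2 + of_int q \<ge> 0"
    unfolding rad by (cases "even m") auto
  have alpha: "alpha N n = of_int b + sqrt ((of_int b)\<^sup>2 + of_int q)"
    using Max_roots_monic_quadratic[OF nonneg]
    by (simp add: alpha_def b_def q_def mult.assoc)
  have "odd n \<Longrightarrow> has_cfrac (alpha N n) (periodic [b + A] [2 * A])"
    unfolding alpha rad using has_cfrac_sqrt_square_plus_1[of A b] A by (simp add: n)
  moreover have "even n \<Longrightarrow> has_cfrac (alpha N n) (periodic [b + A - 1] [1, 2 * A - 2])"
    unfolding alpha rad using has_cfrac_sqrt_square_minus_1[of A b] A by (simp add: n)
  moreover have "alpha N n = of_int N * of_nat (fib n)
      + sqrt ((of_int N)\<^sup>2 * (of_nat (fib n))\<^sup>2 + of_nat (fib n) * of_int (fib_like (2 * N) n))"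
    unfolding alpha by (simp add: b_def q_def power_mult_distrib)
  ultimately show ?thesis unfolding bA A_def[symmetric] by blast
qed

end
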